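(* (i) For every fixed integer $r\ge 2$, $\operatorname{ssat}_r(K_k)=\Theta(k^2)$ as $k\to\infty$; that is, there exist constants $c_r,C_r>0$ and $k_0$, depending only on $r$, such that $c_r k^2\le \operatorname{ssat}_r(K_k)\le C_r k^2$ for all integers $k\ge k_0$. (ii) For every integer $k\ge 3$ there exists a constant $C=C(k)>0$ such that for all integers $r\ge 3$, \[ \tfrac14 r^2\;\le\; \operatorname{ssat}_r(K_k)\;\le\; C(\log r)^{8(k-1)^2}r^2. \]
   Context: All logarithms are to base $2$. For an integer $r\ge 2$, let $\mathcal{G}_r$ denote the family of (finite) complete graphs whose edges are colored with $r$ colors $1,2,\dots,r$ (arbitrary, not necessarily proper, edge-colorings). For $G,G'\in\mathcal{G}_r$, $G'$ extends $G$ if $G'$ can be obtained from $G$ by iteratively adding a new vertex together with colored edges joining the new vertex to all existing vertices (at least one new vertex is added). A graph $G\in\mathcal{G}_r$ is $(r,K_k)$-semisaturated if every $G'\in\mathcal{G}_r$ that extends $G$ contains a new monochromatic $K_k$, i.e. a copy of $K_k$ with all edges of the same color that is not contained in $G$ (so it uses at least one new vertex); $G$ itself is allowed to contain monochromatic copies of $K_k$. Define \[ \operatorname{ssat}_r(K_k):=\min\{|V(G)| : G\in\mathcal{G}_r \text{ is } (r,K_k)\text{-semisaturated}\}. \] *)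

theory Defs
  imports Complex_Main "HOL-Library.Ramsey"
begin

text \<open>
  A complete graph on the vertex set \<open>verts G\<close> whose edges, the two-element subsets
  \<open>nsets (verts G) 2\<close>, carry colors. The value of \<open>color G\<close> on other sets is irrelevant:
  no definition below depends on it.
\<close>

record 'v colored_graph =
  verts :: "'v set"
  color :: "'v set \<Rightarrow> nat"

definition colored_complete :: "nat \<Rightarrow> 'v colored_graph \<Rightarrow> bool" where
  "colored_complete r G \<longleftrightarrow>
     finite (verts G) \<and> color G \<in> nsets (verts G) 2 \<rightarrow> {1..r}"

definition adds_vertex :: "nat \<Rightarrow> 'v colored_graph \<Rightarrow> 'v colored_graph \<Rightarrow> bool" where
  "adds_vertex r G G' \<longleftrightarrow>
     colored_complete r G \<and> colored_complete r G' \<and>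
     (\<exists>v. v \<notin> verts G \<and> verts G' = insert v (verts G)) \<and>
     (\<forall>e \<in> nsets (verts G) 2. color G' e = color G e)"

text \<open>Transitive closure without reflexivity: at least one vertex is added.\<close>

definition extends :: "nat \<Rightarrow> 'v colored_graph \<Rightarrow> 'v colored_graph \<Rightarrow> bool" where
  "extends r G' G \<longleftrightarrow> (adds_vertex r)\<^sup>+\<^sup>+ G G'"

text \<open>
  In a complete graph a copy of \<open>K\<^sub>k\<close> is determined by its set of \<open>k\<close> vertices, and it lies in a
  smaller complete graph iff that set does.
\<close>

definition mono_clique :: "nat \<Rightarrow> nat \<Rightarrow> 'v colored_graph \<Rightarrow> 'v set \<Rightarrow> bool" where
  "mono_clique r k G S \<longleftrightarrow>
     S \<in> nsets (verts G) k \<and> (\<exists>i \<in> {1..r}. \<forall>e \<in> nsets S 2. color G e = i)"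

definition semisaturated :: "nat \<Rightarrow> nat \<Rightarrow> 'v colored_graph \<Rightarrow> bool" where
  "semisaturated r k G \<longleftrightarrow>
     colored_complete r G \<and>
     (\<forall>G'. extends r G' G \<longrightarrow> (\<exists>S. mono_clique r k G' S \<and> \<not> S \<subseteq> verts G))"

text \<open>
  Up to isomorphism every finite graph, together with all its extensions, lives on natural
  numbers. The minimum is attained for \<open>r, k \<ge> 1\<close>: by Ramsey's theorem there is a largest
  \<open>r\<close>-colored complete graph without a monochromatic \<open>K\<^sub>k\<close>, and it is semisaturated.
\<close>

definition ssat :: "nat \<Rightarrow> nat \<Rightarrow> nat" where
  "ssat r k = (LEAST n. \<exists>G :: nat colored_graph. semisaturated r k G \<and> card (verts G) = n)"

end

theory Submission
  imports Defs "HOL-Computational_Algebra.Primes"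
begin

text \<open>
  Only the first added vertex matters, and its edges are an arbitrary vertex coloring \<open>f\<close> of \<open>G\<close>;
  so \<open>G\<close> is semisaturated iff for every such \<open>f\<close> some class \<open>f = i\<close> contains a \<open>K\<^bsub>k-1\<^esub>\<close> of color \<open>i\<close>.

  Lower bound in \<open>k\<close>: give color 2 to the vertices of a maximal family of disjoint color-1 copies of
  \<open>K\<^bsub>k-1\<^esub>\<close> and color 1 to the rest. A color-2 clique meets each member of the family at most once,
  so the family has at least \<open>k - 1\<close> members.

  Lower bound in \<open>r\<close>: if \<open>4 |V| < r\<^sup>2\<close>, peeling off large independent sets of one color after the
  other exhausts \<open>V\<close>, so some \<open>f\<close> has no edge of color \<open>i\<close> inside any class \<open>f = i\<close>.

  Upper bounds: the vertices are the points of an \<open>A \<times> m\<close> grid, and color \<open>a\<close> joins points on a common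
  line of slope \<open>-a\<close> modulo \<open>m\<close>. There are only \<open>r m\<close> lines of slopes \<open>-1, \<dots>, -r\<close>, so when
  \<open>A > r (k - 2)\<close> some class \<open>f = i\<close> contains \<open>k - 1\<close> points of a line of slope \<open>-i\<close>.
  Lines of different slopes meet at most once when \<open>m = r A\<close> (good for fixed \<open>r\<close>) or when
  \<open>m \<ge> A\<close> is prime (good for fixed \<open>k\<close>); Chebyshev's argument yields a prime \<open>m = O(A log A)\<close>.
\<close>

section \<open>Semisaturation and vertex colorings\<close>

text \<open>This holds vacuously for sets with at most one vertex, so for \<open>k = 2\<close> a
  single vertex counts as a \<open>K_{k-1}\<close> of every color.\<close>

definition unicolored :: "'v colored_graph \<Rightarrow> nat \<Rightarrow> 'v set \<Rightarrow> bool" where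
  "unicolored G i S \<longleftrightarrow> (\<forall>e \<in> nsets S 2. color G e = i)"

lemma unicolored_iff:
  "unicolored G i S \<longleftrightarrow> (\<forall>u\<in>S. \<forall>v\<in>S. u \<noteq> v \<longrightarrow> color G {u, v} = i)"
  unfolding unicolored_def by (auto elim!: nsets2_E)

text \<open>Add one vertex \<open>w\<close>, joined to each \<open>v\<close> in color
  \<open>f v\<close>. A new clique must contain \<open>w\<close>, and deleting \<open>w\<close> from
  it leaves \<open>S\<close>. The vertex type is infinite so that a fresh \<open>w\<close> exists: a
  graph on all of a finite type has no extension at all.\<close>

lemma semisaturated_obtains:
  fixes G :: "'v colored_graph"
  assumes G: "semisaturated r k G" and "infinite (UNIV :: 'v set)"
    and f: "f \<in> verts G \<rightarrow> {1..r}"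
  obtains i S where "i \<in> {1..r}" "S \<in> nsets {v \<in> verts G. f v = i} (k - 1)" "unicolored G i S"
proof -
  have col: "colored_complete r G"
    using G by (simp add: semisaturated_def)
  then have fin: "finite (verts G)"
    by (simp add: colored_complete_def)
  then obtain w where w: "w \<notin> verts G"
    using assms(2) by (metis ex_new_if_finite)
  \<comment> \<open>For an edge \<open>{w, v}\<close>, \<open>the_elem (e - {w})\<close> is the
    endpoint \<open>v\<close>.\<close>
  define c where "c e = (if w \<in> e then f (the_elem (e - {w})) else color G e)" for e
  define G' where "G' = \<lparr>verts = insert w (verts G), color = c\<rparr>"
  have c_w: "c {w, v} = f v" "c {v, w} = f v" if "v \<in> verts G" for v
  proof -
    have "{w, v} - {w} = {v}" "{v, w} - {w} = {v}"
      using that w by auto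
    then show "c {w, v} = f v" "c {v, w} = f v"
      by (simp_all add: c_def)
  qed
  have c_old: "c e = color G e" if "e \<in> nsets (verts G) 2" for e
    using that w by (auto simp: c_def nsets_def)
  have "colored_complete r G'"
    unfolding colored_complete_def
  proof (intro conjI Pi_I)
    show "finite (verts G')"
      using fin by (simp add: G'_def)
    fix e assume "e \<in> nsets (verts G') 2"
    then obtain u v where uv: "e = {u, v}" "u \<in> insert w (verts G)" "v \<in> insert w (verts G)" "u \<noteq> v"
      by (auto simp: G'_def elim!: nsets2_E)
    consider "u = w" "v \<in> verts G" | "v = w" "u \<in> verts G" | "u \<in> verts G" "v \<in> verts G"
      using uv by auto
    then show "color G' e \<in> {1..r}"
    proof cases
      case 1
      then show ?thesis using uv c_w[of v] f by (auto simp: G'_def)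
    next
      case 2
      then show ?thesis using uv c_w[of u] f by (auto simp: G'_def)
    next
      case 3
      then have "e \<in> nsets (verts G) 2" using uv by simp
      then show ?thesis using c_old[of e] col by (auto simp: G'_def colored_complete_def)
    qed
  qed
  then have "adds_vertex r G G'"
    unfolding adds_vertex_def using col w c_old by (auto simp: G'_def)
  then have "extends r G' G"
    by (simp add: extends_def)
  then obtain T where T: "mono_clique r k G' T" "\<not> T \<subseteq> verts G"
    using G unfolding semisaturated_def by blast
  then have Tk: "finite T" "card T = k" "T \<subseteq> insert w (verts G)"
    by (auto simp: mono_clique_def nsets_def G'_def)
  then have wT: "w \<in> T"
    using T(2) by auto
  obtain i where i: "i \<in> {1..r}" "\<And>e. e \<in> nsets T 2 \<Longrightarrow> c e = i"
    using T(1) by (auto simp: mono_clique_def G'_def)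
  show ?thesis
  proof (rule that[OF i(1), of "T - {w}"])
    have "f v = i" if "v \<in> T - {w}" for v
      using that c_w(1)[of v] i(2)[of "{w, v}"] wT Tk by auto
    then show "T - {w} \<in> nsets {v \<in> verts G. f v = i} (k - 1)"
      using Tk wT by (auto simp: nsets_def)
    show "unicolored G i (T - {w})"
      unfolding unicolored_def
    proof
      fix e assume e: "e \<in> nsets (T - {w}) 2"
      then have "e \<in> nsets (verts G) 2" "e \<in> nsets T 2"
        using Tk(3) by (auto simp: nsets_def)
      then show "color G e = i"
        using c_old i(2) by metis
    qed
  qed
qed

text \<open>\<open>H\<close> is the first step of the chain from \<open>G\<close> to
  \<open>G'\<close>; later steps change neither its vertices nor its colors.\<close>

lemma extends_imp_adds_vertex:
  assumes "extends r G' G"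
  obtains H where "adds_vertex r G H" "verts H \<subseteq> verts G'"
    "\<And>e. e \<in> nsets (verts H) 2 \<Longrightarrow> color G' e = color H e"
proof -
  have "\<exists>H. adds_vertex r G H \<and> verts H \<subseteq> verts G' \<and>
         (\<forall>e \<in> nsets (verts H) 2. color G' e = color H e)"
    using assms unfolding extends_def
  proof (induction rule: tranclp_induct)
    case (base H)
    then show ?case by blast
  next
    case (step G1 G2)
    then obtain H where H: "adds_vertex r G H" "verts H \<subseteq> verts G1"
      "\<forall>e \<in> nsets (verts H) 2. color G1 e = color H e"
      by blast
    have "verts G1 \<subseteq> verts G2" "\<forall>e \<in> nsets (verts G1) 2. color G2 e = color G1 e"
      using step(2) by (auto simp: adds_vertex_def)
    then show ?case
      using H nsets_mono[OF H(2), of 2] by (metis subset_iff)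
  qed
  then show ?thesis
    using that by blast
qed

text \<open>The converse of \<open>semisaturated_obtains\<close>: the first added vertex
  \<open>w\<close> induces a coloring \<open>f\<close>, and \<open>w\<close> completes the clique
  found in a class of \<open>f\<close> to a \<open>K_k\<close> that survives in every later
  extension.\<close>

lemma semisaturatedI:
  assumes col: "colored_complete r G" and "k \<ge> 1"
    and mono: "\<And>f. f \<in> verts G \<rightarrow> {1..r} \<Longrightarrow>
      \<exists>i\<in>{1..r}. \<exists>S\<in>nsets {v \<in> verts G. f v = i} (k - 1). unicolored G i S"
  shows "semisaturated r k G"
  unfolding semisaturated_def
proof (intro conjI allI impI col)
  fix G' assume "extends r G' G"
  then obtain H where H: "adds_vertex r G H" "verts H \<subseteq> verts G'"
    "\<And>e. e \<in> nsets (verts H) 2 \<Longrightarrow> color G' e = color H e"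
    by (rule extends_imp_adds_vertex) blast
  then obtain w where w: "w \<notin> verts G" "verts H = insert w (verts G)"
    and old: "\<And>e. e \<in> nsets (verts G) 2 \<Longrightarrow> color H e = color G e"
    and colH: "color H \<in> nsets (verts H) 2 \<rightarrow> {1..r}"
    by (auto simp: adds_vertex_def colored_complete_def)
  define f where "f v = color H {v, w}" for v
  have "f \<in> verts G \<rightarrow> {1..r}"
  proof
    fix v assume "v \<in> verts G"
    then have "{v, w} \<in> nsets (verts H) 2" using w by auto
    then show "f v \<in> {1..r}" using colH unfolding f_def by blast
  qed
  then obtain i S where iS: "i \<in> {1..r}" "S \<subseteq> verts G" "\<And>v. v \<in> S \<Longrightarrow> f v = i"
    "finite S" "card S = k - 1" "unicolored G i S"
    using mono[of f] unfolding nsets_def by blast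
  define T where "T = insert w S"
  have T: "finite T" "card T = k" "T \<subseteq> verts H"
    using iS w assms(2) by (auto simp: T_def subset_iff card_insert_if)
  have "color G' e = i" if e: "e \<in> nsets T 2" for e
  proof -
    have eH: "e \<in> nsets (verts H) 2"
      using e T(3) nsets_mono by blast
    obtain u v where uv: "e = {u, v}" "u \<noteq> v" "u \<in> T" "v \<in> T"
      using e by (auto elim!: nsets2_E)
    consider "u = w" "v \<in> S" | "v = w" "u \<in> S" | "u \<in> S" "v \<in> S"
      using uv by (auto simp: T_def)
    then have "color H e = i"
    proof cases
      case 1
      then show ?thesis using iS(3)[of v] uv by (simp add: f_def insert_commute)
    next
      case 2
      then show ?thesis using iS(3)[of u] uv by (simp add: f_def)
    next
      case 3
      then have "color H e = color G e" using old[of e] uv iS(2) by auto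
      then show ?thesis using iS(6) 3 uv by (auto simp: unicolored_iff)
    qed
    then show ?thesis using H(3)[OF eH] by simp
  qed
  then have "mono_clique r k G' T"
    using T H(2) iS(1) by (auto simp: mono_clique_def nsets_def)
  moreover have "\<not> T \<subseteq> verts G"
    using w by (auto simp: T_def)
  ultimately show "\<exists>S. mono_clique r k G' S \<and> \<not> S \<subseteq> verts G"
    by blast
qed

lemma semisaturated_card_ge_clique_size:
  fixes G :: "'v colored_graph"
  assumes G: "semisaturated r k G" and inf: "infinite (UNIV :: 'v set)" and "r \<ge> 2" "k \<ge> 2"
  shows "(k - 1)\<^sup>2 \<le> card (verts G)"
proof (rule ccontr)
  assume small: "\<not> ?thesis"
  have fin: "finite (verts G)"
    using G by (simp add: semisaturated_def colored_complete_def)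
  define packing where "packing \<F> \<longleftrightarrow>
    \<F> \<subseteq> {S \<in> nsets (verts G) (k - 1). unicolored G 1 S} \<and> pairwise disjnt \<F>" for \<F>
  have sub: "\<F> \<subseteq> Pow (verts G)" if "packing \<F>" for \<F>
    using that by (auto simp: packing_def nsets_def)
  have "finite {\<F>. packing \<F>}"
    by (rule finite_subset[of _ "Pow (Pow (verts G))"]) (use sub fin in auto)
  moreover have "packing {}"
    by (simp add: packing_def)
  ultimately obtain \<F> where \<F>: "packing \<F>" and max: "\<And>\<F>'. packing \<F>' \<Longrightarrow> \<F> \<subseteq> \<F>' \<Longrightarrow> \<F> = \<F>'"
    using finite_has_maximal2[of "{\<F>. packing \<F>}" "{}"] by auto
  have fin\<F>: "finite \<F>"
    using sub[OF \<F>] fin by (meson finite_Pow_iff finite_subset)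
  have el: "T \<subseteq> verts G" "finite T" "card T = k - 1" "unicolored G 1 T" if "T \<in> \<F>" for T
    using that \<F> by (auto simp: packing_def nsets_def)
  have "card (\<Union>\<F>) = (\<Sum>T\<in>\<F>. card T)"
    by (rule card_Union_disjoint) (use \<F> el in \<open>auto simp: packing_def\<close>)
  also have "\<dots> = card \<F> * (k - 1)"
    using el by simp
  finally have "card \<F> * (k - 1) \<le> card (verts G)"
    using el by (metis Union_least card_mono fin)
  \<comment> \<open>Disjoint sets of \<open>k - 1\<close> vertices each: fewer than
    \<open>(k - 1)\<^sup>2\<close> vertices leave room for fewer than \<open>k - 1\<close> of
    them.\<close>
  then have "card \<F> * (k - 1) < (k - 1) * (k - 1)"
    using small unfolding power2_eq_square by linarith
  then have card\<F>: "card \<F> < k - 1"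
    by simp
  define f where "f v = (if v \<in> \<Union>\<F> then 2 else 1 :: nat)" for v
  have "f \<in> verts G \<rightarrow> {1..r}"
    using assms(3) by (auto simp: f_def)
  then obtain i S where S: "i \<in> {1..r}" "S \<in> nsets {v \<in> verts G. f v = i} (k - 1)" "unicolored G i S"
    using semisaturated_obtains[OF G inf] by blast
  then have S': "finite S" "card S = k - 1" "S \<subseteq> verts G" "\<And>v. v \<in> S \<Longrightarrow> f v = i"
    by (auto simp: nsets_def)
  have "S \<noteq> {}"
    using S' assms(4) by auto
  then have "i = 1 \<or> i = 2"
    using S'(4) unfolding f_def by (metis ex_in_conv)
  then show False
  proof
    assume "i = 1"
    \<comment> \<open>A color-1 clique on uncovered vertices would enlarge the maximal
      family.\<close>
    then have disj: "S \<inter> T = {}" if "T \<in> \<F>" for T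
      using S'(4) that by (fastforce simp: f_def split: if_splits)
    have "packing (insert S \<F>)"
      using \<F> S \<open>i = 1\<close> disj S' unfolding packing_def pairwise_insert
      by (auto simp: nsets_def disjnt_def)
    then have "S \<in> \<F>"
      using max by blast
    then show False
      using disj \<open>S \<noteq> {}\<close> by auto
  next
    assume "i = 2"
    \<comment> \<open>\<open>t\<close> picks a member covering each vertex of \<open>S\<close>. It
      is injective, since two vertices in one member would be joined by an edge of both color 1 and
      color 2.\<close>
    have cov: "\<exists>T\<in>\<F>. v \<in> T" if "v \<in> S" for v
      using S'(4)[OF that] \<open>i = 2\<close> by (auto simp: f_def split: if_splits)
    then obtain t where t: "\<And>v. v \<in> S \<Longrightarrow> t v \<in> \<F> \<and> v \<in> t v"
      by metis
    have "inj_on t S"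
    proof (rule inj_onI, rule ccontr)
      fix u v assume uv: "u \<in> S" "v \<in> S" "t u = t v" "u \<noteq> v"
      then have "color G {u, v} = 2"
        using S(3) \<open>i = 2\<close> by (simp add: unicolored_iff)
      moreover have "color G {u, v} = 1"
        using el(4)[of "t u"] t[of u] t[of v] uv by (auto simp: unicolored_iff)
      ultimately show False by simp
    qed
    then have "card S \<le> card \<F>"
      using t fin\<F> by (intro card_inj_on_le[of t]) auto
    then show False
      using card\<F> S' by simp
  qed
qed

section \<open>Independent sets of one color\<close>

text \<open>The Caro-Wei bound, by the greedy algorithm: pick a vertex \<open>w\<close> of least
  degree and delete it with its neighbors. The deleted vertices have degree at least that of
  \<open>w\<close>, so together they contribute at most 1 to the sum, while the terms of the
  remaining vertices only grow.\<close>

lemma independent_set_caro_wei: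
  fixes E :: "'v \<Rightarrow> 'v \<Rightarrow> bool"
  assumes "finite V" and sym: "\<And>u v. E u v \<Longrightarrow> E v u" and irrefl: "\<And>v. \<not> E v v"
  shows "\<exists>J\<subseteq>V. (\<forall>u\<in>J. \<forall>v\<in>J. \<not> E u v) \<and>
           (\<Sum>v\<in>V. 1 / (real (card {u\<in>V. E v u}) + 1)) \<le> real (card J)"
  using assms(1)
proof (induction V rule: finite_psubset_induct)
  case (psubset V)
  define d where "d W v = card {u\<in>W. E v u}" for W v
  show ?case
  proof (cases "V = {}")
    case False
    then obtain w where w: "w \<in> V" "\<And>v. v \<in> V \<Longrightarrow> d V w \<le> d V v"
      using arg_min_if_finite(1)[OF psubset(1) False, of "d V"]
        arg_min_least[OF psubset(1) False, of _ "d V"] by blast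
    define N where "N = {u\<in>V. E w u}"
    define W where "W = V - insert w N"
    have finN: "finite N" "finite W" and NV: "insert w N \<subseteq> V" and wN: "w \<notin> N"
      using psubset(1) w(1) irrefl by (auto simp: N_def W_def)
    have "W \<subset> V"
      using w(1) by (auto simp: W_def)
    then obtain J where J: "J \<subseteq> W" "\<forall>u\<in>J. \<forall>v\<in>J. \<not> E u v" "(\<Sum>v\<in>W. 1 / (real (d W v) + 1)) \<le> real (card J)"
      using psubset(2)[of W] unfolding d_def by blast
    have "(\<Sum>v\<in>V. 1 / (real (d V v) + 1)) =
        (\<Sum>v\<in>W. 1 / (real (d V v) + 1)) + (\<Sum>v\<in>insert w N. 1 / (real (d V v) + 1))"
      unfolding W_def by (rule sum.subset_diff[OF NV psubset(1)])
    also have "(\<Sum>v\<in>W. 1 / (real (d V v) + 1)) \<le> (\<Sum>v\<in>W. 1 / (real (d W v) + 1))"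
    proof (rule sum_mono)
      fix v
      have "d W v \<le> d V v"
        unfolding d_def by (rule card_mono) (use psubset(1) in \<open>auto simp: W_def\<close>)
      then show "1 / (real (d V v) + 1) \<le> 1 / (real (d W v) + 1)"
        by (intro divide_left_mono) auto
    qed
    also have "(\<Sum>v\<in>insert w N. 1 / (real (d V v) + 1)) \<le> (\<Sum>v\<in>insert w N. 1 / (real (card N) + 1))"
    proof (rule sum_mono)
      fix v assume "v \<in> insert w N"
      then have "card N \<le> d V v"
        using w(2)[of v] NV by (auto simp: d_def N_def)
      then show "1 / (real (d V v) + 1) \<le> 1 / (real (card N) + 1)"
        by (intro divide_left_mono) auto
    qed
    also have "\<dots> = 1"
      using finN wN by simp
    finally have "(\<Sum>v\<in>V. 1 / (real (d V v) + 1)) \<le> real (card (insert w J))"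
      using J finN w(1) by (auto simp: W_def card_insert_if finite_subset)
    moreover have "\<not> E w v" if "v \<in> J" for v
      using that J(1) by (auto simp: W_def N_def)
    then have "\<forall>u\<in>insert w J. \<forall>v\<in>insert w J. \<not> E u v"
      using J(2) irrefl sym by blast
    moreover have "insert w J \<subseteq> V"
      using J(1) w(1) by (auto simp: W_def)
    ultimately show ?thesis
      unfolding d_def by blast
  qed auto
qed

text \<open>Apply Caro-Wei to every color in \<open>I\<close> and average. At each vertex the
  degrees in different colors sum to at most \<open>m - 1\<close>, so by AM-HM the sum over
  \<open>i\<close> of \<open>1 / d i v\<close> is at least \<open>s\<^sup>2 / (m + s - 1)\<close>;
  hence some color has an independent set of size at least
  \<open>m * s / (m + s - 1)\<close>.\<close>

lemma large_independent_color:
  fixes c :: "'v set \<Rightarrow> 'i"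
  assumes "finite V" "V \<noteq> {}" "finite I" "I \<noteq> {}"
  obtains i J where "i \<in> I" "J \<subseteq> V" "\<And>u v. u \<in> J \<Longrightarrow> v \<in> J \<Longrightarrow> u \<noteq> v \<Longrightarrow> c {u, v} \<noteq> i"
    "real (card V) * real (card I) \<le> real (card J) * (real (card V) + real (card I) - 1)"
proof -
  define m s where "m = real (card V)" and "s = real (card I)"
  have ms: "m \<ge> 1" "s \<ge> 1"
    using assms by (auto simp: m_def s_def Suc_le_eq card_gt_0_iff)
  define d where "d i v = real (card {u\<in>V. v \<noteq> u \<and> c {v, u} = i}) + 1" for i v
  have "\<exists>J\<subseteq>V. (\<forall>u\<in>J. \<forall>v\<in>J. \<not> (u \<noteq> v \<and> c {u, v} = i)) \<and> (\<Sum>v\<in>V. 1 / d i v) \<le> real (card J)" for i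
    unfolding d_def
    by (rule independent_set_caro_wei[OF assms(1), of "\<lambda>v u. v \<noteq> u \<and> c {v, u} = i"])
       (auto simp: insert_commute)
  then obtain J where "\<forall>i. J i \<subseteq> V \<and> (\<forall>u\<in>J i. \<forall>v\<in>J i. \<not> (u \<noteq> v \<and> c {u, v} = i)) \<and>
      (\<Sum>v\<in>V. 1 / d i v) \<le> real (card (J i))"
    using choice[of "\<lambda>i J. J \<subseteq> V \<and> (\<forall>u\<in>J. \<forall>v\<in>J. \<not> (u \<noteq> v \<and> c {u, v} = i)) \<and>
      (\<Sum>v\<in>V. 1 / d i v) \<le> real (card J)"] by blast
  then have J: "\<And>i. J i \<subseteq> V" "\<And>i u v. u \<in> J i \<Longrightarrow> v \<in> J i \<Longrightarrow> u \<noteq> v \<Longrightarrow> c {u, v} \<noteq> i"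
    "\<And>i. (\<Sum>v\<in>V. 1 / d i v) \<le> real (card (J i))"
    by blast+
  \<comment> \<open>An upper bound, valid at every vertex, for the average of \<open>d i v\<close>
    over the colors in \<open>I\<close>.\<close>
  define a where "a = (m + s - 1) / s"
  have a: "a > 0"
    using ms by (simp add: a_def)
  have deg: "(\<Sum>i\<in>I. d i v) \<le> m + s - 1" if v: "v \<in> V" for v
  proof -
    have "(\<Sum>i\<in>I. card {u\<in>V. v \<noteq> u \<and> c {v, u} = i}) = card (\<Union>i\<in>I. {u\<in>V. v \<noteq> u \<and> c {v, u} = i})"
      by (rule card_UN_disjoint[symmetric]) (use assms in auto)
    also have "\<dots> \<le> card (V - {v})"
      by (rule card_mono) (use assms in auto)
    also have "real \<dots> = m - 1"
      using v assms(1) ms by (simp add: m_def)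
    finally show ?thesis
      by (simp add: d_def sum.distrib s_def of_nat_sum)
  qed
  \<comment> \<open>\<open>1 / x\<close> lies above its tangent at the average \<open>a\<close>, whence the AM-HM inequality below.\<close>
  have tangent: "1 / x \<ge> 2 / a - x / a\<^sup>2" if "x > 0" for x
  proof -
    have "0 \<le> (x - a)\<^sup>2 / (x * a\<^sup>2)"
      using that by simp
    also have "\<dots> = 1 / x - (2 / a - x / a\<^sup>2)"
      using that a by (simp add: field_simps power2_eq_square)
    finally show ?thesis by simp
  qed
  have vert: "s / a \<le> (\<Sum>i\<in>I. 1 / d i v)" if v: "v \<in> V" for v
  proof -
    have "m + s - 1 = s * a"
      using ms by (simp add: a_def)
    then have "s / a = s * (2 / a) - (m + s - 1) / a\<^sup>2"
      using a by (simp add: power2_eq_square)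
    also have "\<dots> \<le> s * (2 / a) - (\<Sum>i\<in>I. d i v) / a\<^sup>2"
      using deg[OF v] a by (intro diff_left_mono divide_right_mono) auto
    also have "\<dots> = (\<Sum>i\<in>I. 2 / a - d i v / a\<^sup>2)"
      by (simp add: sum_subtractf sum_divide_distrib s_def)
    also have "\<dots> \<le> (\<Sum>i\<in>I. 1 / d i v)"
      by (intro sum_mono tangent) (simp add: d_def)
    finally show ?thesis .
  qed
  have "m * (s / a) = (\<Sum>v\<in>V. s / a)"
    by (simp add: m_def)
  also have "\<dots> \<le> (\<Sum>v\<in>V. \<Sum>i\<in>I. 1 / d i v)"
    by (intro sum_mono vert)
  also have "\<dots> = (\<Sum>i\<in>I. \<Sum>v\<in>V. 1 / d i v)"
    by (rule sum.swap)
  also have "\<dots> \<le> (\<Sum>i\<in>I. real (card (J i)))"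
    by (intro sum_mono J)
  finally have tot: "m * (s / a) \<le> (\<Sum>i\<in>I. real (card (J i)))" .
  have "\<exists>i\<in>I. m / a \<le> real (card (J i))"
  proof (rule ccontr)
    assume "\<not> ?thesis"
    then have "(\<Sum>i\<in>I. real (card (J i))) < (\<Sum>i\<in>I. m / a)"
      using assms by (intro sum_strict_mono) auto
    then show False
      using tot by (simp add: s_def mult.commute)
  qed
  then obtain i where i: "i \<in> I" "m / a \<le> real (card (J i))"
    by blast
  then have "m * s \<le> real (card (J i)) * (m + s - 1)"
    using ms by (simp add: a_def field_simps)
  then show ?thesis
    using that[OF i(1), of "J i"] J(1,2) by (simp add: m_def s_def)
qed

text \<open>Induction on the number of colors: make the large independent set \<open>J\<close> of
  some color \<open>i\<close> the class of \<open>i\<close>, then color the rest without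
  \<open>i\<close>. The hypothesis is shaped to survive this step: going from \<open>t + 1\<close>
  colors to \<open>t\<close>, \<open>J\<close> is large enough to bring \<open>4 * card V\<close>
  below \<open>t\<^sup>2\<close>.\<close>

lemma independent_color_partition:
  fixes c :: "'v set \<Rightarrow> 'i"
  assumes "finite V" "finite I" "4 * card V < (card I)\<^sup>2"
  shows "\<exists>f \<in> V \<rightarrow> I. \<forall>u\<in>V. \<forall>v\<in>V. u \<noteq> v \<longrightarrow> f u = f v \<longrightarrow> c {u, v} \<noteq> f u"
  using assms
proof (induction "card I" arbitrary: I V)
  case 0
  then show ?case by simp
next
  case (Suc t)
  show ?case
  proof (cases "V = {}")
    case False
    have I: "I \<noteq> {}"
      using Suc(2) by auto
    obtain i J where iJ: "i \<in> I" "J \<subseteq> V" "\<And>u v. u \<in> J \<Longrightarrow> v \<in> J \<Longrightarrow> u \<noteq> v \<Longrightarrow> c {u, v} \<noteq> i"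
      and large: "real (card V) * real (card I) \<le> real (card J) * (real (card V) + real (card I) - 1)"
      using large_independent_color[of V I c] False Suc(3,4) I by blast
    define m s j where "m = real (card V)" and "s = real t" and "j = real (card J)"
    have m: "m \<ge> 1" and s: "s \<ge> 0" and jm: "j \<le> m"
      using False Suc(3) iJ(2) by (auto simp: m_def s_def j_def Suc_le_eq card_gt_0_iff card_mono)
    have "4 * card V < (t + 1)\<^sup>2"
      using Suc by simp
    \<comment> \<open>Integrality gains the 1 that makes the bound factor as
      \<open>t * (t + 2)\<close>.\<close>
    then have "4 * card V \<le> t\<^sup>2 + 2 * t"
      by (simp add: power2_eq_square)
    then have "real (4 * card V) \<le> real (t\<^sup>2 + 2 * t)"
      by (simp only: of_nat_le_iff)
    then have ms: "4 * m \<le> s\<^sup>2 + 2 * s"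
      unfolding m_def s_def by simp
    have J: "m * (s + 1) \<le> j * (m + s)"
      using large unfolding Suc(2)[symmetric] m_def s_def j_def by (simp add: add.commute)
    have s1: "s > 0"
      using m ms s by (cases "s = 0") auto
    have "4 * (m - j) * (m + s) \<le> 4 * m * (m - 1)"
      using J by (simp add: algebra_simps)
    also have "\<dots> \<le> (s\<^sup>2 + 2 * s) * (m - 1)"
      using ms m by (intro mult_right_mono) auto
    also have "\<dots> < s\<^sup>2 * (m + s)"
    proof -
      have "(s + 2) * (m - 1) < s * (m + s)"
        using ms zero_le_square[of s] s1 unfolding power2_eq_square ring_distribs by linarith
      then have "s * ((s + 2) * (m - 1)) < s * (s * (m + s))"
        using s1 by simp
      then show ?thesis by (simp add: algebra_simps power2_eq_square)
    qed
    finally have "4 * (m - j) < s\<^sup>2"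
      using m s by (simp add: mult_less_cancel_right)
    moreover have "card (V - J) = card V - card J"
      using iJ(2) Suc(3) by (simp add: card_Diff_subset finite_subset)
    ultimately have "real (4 * card (V - J)) < real (t\<^sup>2)"
      using jm by (simp add: m_def s_def j_def of_nat_diff)
    then have "4 * card (V - J) < t\<^sup>2"
      by (simp only: of_nat_less_iff)
    moreover have "t = card (I - {i})"
      using Suc(2,4) iJ(1) by simp
    ultimately have "\<exists>f \<in> (V - J) \<rightarrow> (I - {i}). \<forall>u\<in>V - J. \<forall>v\<in>V - J. u \<noteq> v \<longrightarrow> f u = f v \<longrightarrow> c {u, v} \<noteq> f u"
      using Suc(3,4) by (intro Suc(1)) auto
    then obtain f where f: "f \<in> (V - J) \<rightarrow> (I - {i})"
      "\<forall>u\<in>V - J. \<forall>v\<in>V - J. u \<noteq> v \<longrightarrow> f u = f v \<longrightarrow> c {u, v} \<noteq> f u"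
      by blast
    define g where "g v = (if v \<in> J then i else f v)" for v
    have "g \<in> V \<rightarrow> I"
      using f(1) iJ(1) by (auto simp: g_def)
    moreover have "c {u, v} \<noteq> g u" if "u \<in> V" "v \<in> V" "u \<noteq> v" "g u = g v" for u v
    proof (cases "u \<in> J \<longleftrightarrow> v \<in> J")
      case True
      then show ?thesis using that f(2) iJ(3) by (auto simp: g_def)
    next
      case False
      \<comment> \<open>A vertex of \<open>J\<close> and one outside never share a class, because
        \<open>f\<close> avoids \<open>i\<close>.\<close>
      then have "f u = i \<and> u \<in> V - J \<or> f v = i \<and> v \<in> V - J"
        using that by (auto simp: g_def split: if_splits)
      then show ?thesis using f(1) by blast
    qed
    ultimately show ?thesis by blast
  qed auto
qed

section \<open>A Chebyshev bound for primes\<close>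

text \<open>The numbers \<open>1 / (m * (n choose m))\<close> form Leibniz' harmonic triangle. Those
  with \<open>m = 1\<close> are \<open>1 / n\<close>, and all others arise by subtraction, so
  multiplying by a common multiple \<open>K\<close> of \<open>1, ..., n\<close> makes them
  integers.\<close>

lemma mult_binomial_dvd:
  fixes K :: nat
  assumes "\<And>j. 1 \<le> j \<Longrightarrow> j \<le> n \<Longrightarrow> j dvd K" "1 \<le> m" "m \<le> n"
  shows "m * (n choose m) dvd K"
  using assms(2,3,1)
proof (induction m arbitrary: n rule: nat_induct_at_least)
  case base
  then show ?case by simp
next
  case (Suc m)
  obtain N where n: "n = Suc N"
    using Suc.prems(1) by (cases n) auto
  \<comment> \<open>\<open>x\<close> and \<open>y\<close> are \<open>K\<close> times the two entries
    to be subtracted; the new cofactor is \<open>y - x\<close>, formed in the integers to avoid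
    truncation.\<close>
  obtain x where x: "K = m * (Suc N choose m) * x"
    using Suc.IH[of n] Suc.prems n by auto
  obtain y where y: "K = m * (N choose m) * y"
    using Suc.IH[of N] Suc.prems n by auto
  obtain l where l: "m = Suc l"
    using Suc.hyps by (cases m) auto
  \<comment> \<open>This is the recurrence of Leibniz' harmonic triangle,
    \<open>1 / ((m + 1) (N + 1 choose m + 1)) = 1 / (m (N choose m)) - 1 / (m (N + 1 choose m))\<close>,
    multiplied by \<open>K\<close>.\<close>
  define b where "b = int (N choose l)"
  have e1: "int m * int (Suc N choose m) = (int N + 1) * b"
    using Suc_times_binomial[of l N] unfolding l b_def
    by (metis of_nat_Suc of_nat_mult add.commute)
  have "m * (N choose m) = (N - l) * (N choose l)"
    using binomial_absorption[of l N] binomial_absorb_comp[of N l] unfolding l by simp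
  then have e2: "int m * int (N choose m) = (int N - int l) * b"
    using Suc.prems(1) n l unfolding b_def by (metis Suc_leD Suc_le_mono of_nat_diff of_nat_mult)
  have e3: "int (Suc m) * int (Suc N choose Suc m) = (int N + 1) * int (N choose m)"
    using Suc_times_binomial[of m N] by (metis of_nat_Suc of_nat_mult add.commute)
  have Kx: "int K = (int N + 1) * b * int x"
    using x e1 by (metis of_nat_mult)
  have Ky: "int K = (int N - int l) * b * int y"
    using y e2 by (metis of_nat_mult)
  have "int m * int K = int m * ((int N + 1) * int (N choose m) * (int y - int x))"
  proof -
    have "int m * ((int N + 1) * int (N choose m) * (int y - int x))
        = (int N + 1) * (int m * int (N choose m)) * (int y - int x)"
      by (simp add: algebra_simps)
    also have "\<dots> = (int N + 1) * ((int N - int l) * b * int y) - (int N - int l) * ((int N + 1) * b * int x)"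
      unfolding e2 by (simp add: algebra_simps)
    also have "\<dots> = (int N + 1) * int K - (int N - int l) * int K"
      by (simp only: flip: Kx Ky)
    also have "\<dots> = int m * int K"
      using l by (simp add: algebra_simps)
    finally show ?thesis by (rule sym)
  qed
  then have "int K = int (Suc m) * int (Suc N choose Suc m) * (int y - int x)"
    using l unfolding e3 by simp
  then have "int (Suc m * (n choose Suc m)) dvd int K"
    unfolding n by (metis dvd_triv_left of_nat_mult)
  then show ?case
    by (simp only: of_nat_dvd_iff)
qed

text \<open>The multiplicity of \<open>p\<close> in an lcm is the largest of its multiplicities in
  the arguments, so \<open>p ^ e\<close> already divides one of \<open>1, ..., n\<close>.\<close>

lemma prime_power_dvd_Lcm_atMost:
  fixes p :: nat
  assumes "prime p" "p ^ e dvd Lcm {1..n}" "n \<ge> 1"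
  shows "p ^ e \<le> n"
  using assms(3,2)
proof (induction n rule: nat_induct_at_least)
  case base
  then show ?case by (simp add: dvd_imp_le)
next
  case (Suc n)
  have "Lcm {1..n} \<noteq> 0"
    by (simp add: Lcm_0_iff)
  moreover have L: "Lcm {1..Suc n} = lcm (Suc n) (Lcm {1..n})"
    by (simp add: atLeastAtMostSuc_conv)
  ultimately have "e \<le> max (multiplicity p (Suc n)) (multiplicity p (Lcm {1..n}))"
    using Suc.prems assms(1)
    by (metis multiplicity_lcm nat.distinct(1) not_prime_unit multiplicity_geI lcm_eq_0_iff)
  then have "p ^ e dvd Suc n \<or> p ^ e dvd Lcm {1..n}"
    by (auto simp: le_max_iff_disj intro: multiplicity_dvd')
  then show ?case
    using Suc.IH by (auto dest: dvd_imp_le)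
qed

lemma Lcm_atMost_le_power_card_primes:
  fixes n :: nat
  assumes "n \<ge> 1"
  shows "Lcm {1..n} \<le> n ^ card {p. prime p \<and> p \<le> n}"
proof -
  let ?L = "Lcm {1..n}"
  have "?L = (\<Prod>p\<in>prime_factors ?L. p ^ multiplicity p ?L)"
    by (rule prime_factorization_nat) (simp add: Lcm_0_iff zero_less_iff_neq_zero)
  also have "\<dots> \<le> (\<Prod>p\<in>prime_factors ?L. n)"
    by (intro prod_mono conjI prime_power_dvd_Lcm_atMost assms)
       (auto simp: multiplicity_dvd in_prime_factors_iff)
  also have "\<dots> = n ^ card (prime_factors ?L)"
    by simp
  also have "\<dots> \<le> n ^ card {p. prime p \<and> p \<le> n}"
  proof (rule power_increasing)
    have "prime_factors ?L \<subseteq> {p. prime p \<and> p \<le> n}"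
      using prime_power_dvd_Lcm_atMost[of _ 1] assms by (auto simp: in_prime_factors_iff)
    then show "card (prime_factors ?L) \<le> card {p. prime p \<and> p \<le> n}"
      by (intro card_mono) auto
  qed (use assms in simp)
  finally show ?thesis .
qed

text \<open>Both sides are compared with \<open>Lcm {1..2 * n}\<close>: it is a multiple of
  \<open>n * (2 * n choose n)\<close>, which is at least \<open>4 ^ n / 2\<close>, and each prime up
  to \<open>2 * n\<close> contributes at most a factor \<open>2 * n\<close>.\<close>

lemma two_power_le_card_primes:
  assumes "n \<ge> 1"
  shows "2 ^ (2 * n - 1) \<le> (2 * n) ^ card {p::nat. prime p \<and> p \<le> 2 * n}"
proof -
  have "n * (2 * n choose n) dvd Lcm {1..2 * n}"
    using assms by (intro mult_binomial_dvd) auto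
  then have "n * (2 * n choose n) \<le> Lcm {1..2 * n}"
    by (rule dvd_imp_le) (simp add: Lcm_0_iff zero_less_iff_neq_zero)
  moreover have "4 ^ n \<le> 2 * (n * (2 * n choose n))"
  proof -
    have "4 ^ n \<le> 2 * real n * real (2 * n choose n)"
      using central_binomial_lower_bound[of n] assms by (simp add: field_simps)
    then have "real (4 ^ n) \<le> real (2 * (n * (2 * n choose n)))"
      by simp
    then show ?thesis
      by (simp only: of_nat_le_iff)
  qed
  moreover have "(4::nat) ^ n = 2 * 2 ^ (2 * n - 1)"
    using assms by (cases n) (auto simp: power_mult power2_eq_square)
  ultimately have "2 ^ (2 * n - 1) \<le> Lcm {1..2 * n}"
    by linarith
  also have "\<dots> \<le> (2 * n) ^ card {p. prime p \<and> p \<le> 2 * n}"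
    using assms by (intro Lcm_atMost_le_power_card_primes) auto
  finally show ?thesis .
qed

section \<open>A prime of size \<open>O(A log A)\<close> above \<open>A\<close>\<close>

lemma ex_power_two_between:
  assumes "c \<ge> (1::nat)"
  obtains b where "c \<le> 2 ^ b" "2 ^ b < 2 * c"
proof -
  define b where "b = (LEAST b. c \<le> 2 ^ b)"
  have b: "c \<le> 2 ^ b"
    unfolding b_def by (rule LeastI[of _ c]) (simp add: less_imp_le less_exp)
  moreover have "2 ^ b < 2 * c"
  proof (cases b)
    case (Suc b')
    then have "\<not> c \<le> 2 ^ b'"
      using not_less_Least[of b' "\<lambda>b. c \<le> 2 ^ b"] b_def by auto
    then show ?thesis using Suc by simp
  qed (use assms in simp)
  ultimately show ?thesis using that by blast
qed

text \<open>Without primes between \<open>A\<close> and \<open>2 * n\<close> there are at most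
  \<open>A\<close> primes up to \<open>2 * n\<close>, too few for the Chebyshev bound once
  \<open>n\<close> is of order \<open>A log A\<close>. Rounding to powers of two turns this into a
  comparison of exponents.\<close>

lemma ex_prime_ge_le:
  assumes "A \<ge> (2::nat)"
  obtains p where "prime p" "A \<le> p" "real p \<le> 16 * real A * (log 2 (real A) + 2)"
proof -
  obtain a where a: "A \<le> 2 ^ a" "2 ^ a < 2 * A"
    using ex_power_two_between[of A] assms by auto
  \<comment> \<open>The factor 4 secures \<open>a + b + 1 \<le> 2 ^ b\<close>: \<open>a + 1\<close>
    is at most a quarter and \<open>b\<close> at most half of \<open>2 ^ b\<close>.\<close>
  obtain b where b: "4 * (a + 1) \<le> 2 ^ b" "2 ^ b < 2 * (4 * (a + 1))"
    using ex_power_two_between[of "4 * (a + 1)"] by auto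
  have a1: "a \<ge> 1"
    using a(1) assms by (cases a) auto
  have b1: "b \<ge> 1"
    using b(1) by (cases b) auto
  have "2 * b \<le> (2::nat) ^ b"
    using b1
  proof (induction b rule: nat_induct_at_least)
    case (Suc b)
    have "2 \<le> 2 * b"
      using Suc.hyps by simp
    then have "2 * Suc b \<le> 2 * (2 * b)"
      by simp
    also have "\<dots> \<le> 2 ^ Suc b"
      using Suc.IH by simp
    finally show ?case .
  qed simp
  moreover have "a + b + 1 \<le> X" if "2 * b \<le> X" "4 * (a + 1) \<le> X" for X :: nat
    using that by presburger
  ultimately have ab: "a + b + 1 \<le> 2 ^ b"
    using b(1) by simp
  define n :: nat where "n = 2 ^ (a + b - 1)"
  have n2: "2 * n = 2 ^ (a + b)"
    using a1 power_minus_mult[of "a + b" "2 :: nat"] by (simp add: n_def mult.commute)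
  have n1: "n \<ge> 1"
    by (simp add: n_def)
  have "\<exists>p. prime p \<and> A \<le> p \<and> p \<le> 2 * n"
  proof (rule ccontr)
    assume none: "\<not> ?thesis"
    have "{p. prime p \<and> p \<le> 2 * n} \<subseteq> {..<A}"
    proof
      fix p assume "p \<in> {p. prime p \<and> p \<le> 2 * n}"
      then have "\<not> A \<le> p"
        using none by blast
      then show "p \<in> {..<A}"
        by simp
    qed
    then have "card {p. prime p \<and> p \<le> 2 * n} \<le> card {..<A}"
      by (rule card_mono[rotated]) simp
    then have "card {p. prime p \<and> p \<le> 2 * n} \<le> 2 ^ a"
      using a(1) by (simp del: card_Collect_le_nat)
    then have "(2 * n) ^ card {p. prime p \<and> p \<le> 2 * n} \<le> (2 * n) ^ (2 ^ a)"
      using n1 by (intro power_increasing) auto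
    then have "(2::nat) ^ (2 * n - 1) \<le> (2 * n) ^ (2 ^ a)"
      using two_power_le_card_primes[OF n1] by (rule order_trans[rotated])
    also have "\<dots> = 2 ^ ((a + b) * 2 ^ a)"
      unfolding n2 by (rule power_mult[symmetric])
    finally have "2 * n - 1 \<le> (a + b) * 2 ^ a"
      by (rule power_le_imp_le_exp[rotated]) simp
    moreover have "(a + b + 1) * 2 ^ a \<le> 2 * n"
      unfolding n2 power_add mult.commute[of "2 ^ a"] by (rule mult_right_mono[OF ab]) simp
    moreover have "(2::nat) ^ a \<ge> 2 ^ 1"
      using a1 by (intro power_increasing) auto
    \<comment> \<open>With \<open>x = 2 * n\<close>, \<open>c = a + b\<close>,
      \<open>q = 2 ^ a\<close>: the surplus \<open>q\<close> exceeds the 1 lost in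
      \<open>2 * n - 1\<close>.\<close>
    moreover have False if "x - 1 \<le> c * q" "(c + 1) * q \<le> x" "2 ^ 1 \<le> q" for x c q :: nat
      using that by (simp add: add_mult_distrib)
    ultimately show False
      by metis
  qed
  then obtain p where p: "prime p" "A \<le> p" "p \<le> 2 * n"
    by blast
  have "log 2 (2 ^ a) \<le> log 2 (2 * real A)"
  proof (subst log_le_cancel_iff)
    have "real (2 ^ a) \<le> real (2 * A)"
      using a(2) by (simp only: of_nat_le_iff)
    then show "2 ^ a \<le> 2 * real A"
      by simp
  qed (use assms in auto)
  then have "real a \<le> log 2 (real A) + 1"
    using assms by (simp add: log_mult)
  moreover have "real p \<le> 16 * real A * (real a + 1)"
  proof -
    have "p \<le> 2 ^ a * 2 ^ b"
      using p n2 by (simp add: power_add)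
    also have "\<dots> \<le> (2 * A) * (2 * (4 * (a + 1)))"
      using a b by (intro mult_mono) auto
    finally have "real p \<le> real ((2 * A) * (2 * (4 * (a + 1))))"
      by (simp only: of_nat_le_iff)
    then show ?thesis by (simp add: algebra_simps)
  qed
  moreover have "16 * real A * (real a + 1) \<le> 16 * real A * (log 2 (real A) + 2)"
    using calculation(1) by (intro mult_left_mono) auto
  ultimately have "real p \<le> 16 * real A * (log 2 (real A) + 2)"
    by linarith
  then show ?thesis
    using that p by blast
qed

section \<open>Colorings by lines and the bounds\<close>

text \<open>Read \<open>f a v\<close> as the line of direction \<open>a\<close> through
  \<open>v\<close>; by \<open>uniq\<close>, two points share a line in at most one direction, which
  colors their edge. A vertex coloring \<open>g\<close> splits \<open>V\<close> into at most
  \<open>r * L\<close> cells, the points with \<open>g v = i\<close> on one line of direction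
  \<open>i\<close>. By \<open>big\<close> some cell has \<open>k - 1\<close> points, and these form
  a clique of color \<open>i\<close>.\<close>

lemma ex_semisaturated_of_lines:
  fixes f :: "nat \<Rightarrow> 'v \<Rightarrow> 'l"
  assumes V: "finite V" and "r \<ge> 1" "k \<ge> 2"
    and uniq: "\<And>a b u v. a \<in> {1..r} \<Longrightarrow> b \<in> {1..r} \<Longrightarrow> u \<in> V \<Longrightarrow> v \<in> V \<Longrightarrow> u \<noteq> v \<Longrightarrow>
      f a u = f a v \<Longrightarrow> f b u = f b v \<Longrightarrow> a = b"
    and lines: "\<And>a. a \<in> {1..r} \<Longrightarrow> card (f a ` V) \<le> L"
    and big: "r * L * (k - 2) < card V"
  shows "\<exists>G. semisaturated r k G \<and> verts G = V"
proof -
  define P where "P e a \<longleftrightarrow> a \<in> {1..r} \<and> (\<forall>u\<in>e. \<forall>v\<in>e. f a u = f a v)" for e a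
  \<comment> \<open>Pairs on no common line get the default color 1.\<close>
  define c where "c e = (if \<exists>a. P e a then SOME a. P e a else 1)" for e
  define G where "G = \<lparr>verts = V, color = c\<rparr>"
  have "c e \<in> {1..r}" for e
  proof (cases "\<exists>a. P e a")
    case True
    then have "P e (SOME a. P e a)"
      by (rule someI_ex)
    with True show ?thesis
      unfolding c_def P_def[of e "SOME a. P e a"] by simp
  qed (use assms(2) in \<open>simp add: c_def\<close>)
  then have col: "colored_complete r G"
    using V by (auto simp: colored_complete_def G_def)
  have c_line: "c {u, v} = a" if "a \<in> {1..r}" "u \<in> V" "v \<in> V" "u \<noteq> v" "f a u = f a v" for a u v
  proof -
    have "P {u, v} a"
      using that by (simp add: P_def)
    moreover from this have "P {u, v} (SOME a. P {u, v} a)"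
      by (rule someI)
    ultimately show ?thesis
      using uniq[of "SOME a. P {u, v} a" a u v] that \<open>P {u, v} a\<close>
      unfolding c_def P_def[of "{u, v}" "SOME a. P {u, v} a"] by (metis insertCI)
  qed
  have "semisaturated r k G"
  proof (rule semisaturatedI[OF col])
    fix g assume "g \<in> verts G \<rightarrow> {1..r}"
    then have g: "\<And>v. v \<in> V \<Longrightarrow> g v \<in> {1..r}"
      by (auto simp: G_def)
    define F where "F i y = {v\<in>V. g v = i \<and> f i v = y}" for i y
    have "\<exists>i\<in>{1..r}. \<exists>y\<in>f i ` V. k - 1 \<le> card (F i y)"
    proof (rule ccontr)
      assume none: "\<not> ?thesis"
      have few: "card (F i y) \<le> k - 2" if "i \<in> {1..r}" "y \<in> f i ` V" for i y
      proof -
        have "\<not> k - 1 \<le> card (F i y)"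
          using none that by blast
        then show ?thesis by linarith
      qed
      have "V \<subseteq> (\<Union>i\<in>{1..r}. \<Union>y\<in>f i ` V. F i y)"
        using g by (auto simp: F_def)
      then have "card V \<le> card (\<Union>i\<in>{1..r}. \<Union>y\<in>f i ` V. F i y)"
        by (rule card_mono[rotated]) (use V in \<open>auto simp: F_def\<close>)
      also have "\<dots> \<le> (\<Sum>i\<in>{1..r}. card (\<Union>y\<in>f i ` V. F i y))"
        by (rule card_UN_le) simp
      also have "\<dots> \<le> (\<Sum>i\<in>{1..r}. L * (k - 2))"
      proof (rule sum_mono)
        fix i assume i: "i \<in> {1..r}"
        have "card (\<Union>y\<in>f i ` V. F i y) \<le> (\<Sum>y\<in>f i ` V. card (F i y))"
          by (rule card_UN_le) (use V in simp)
        also have "\<dots> \<le> card (f i ` V) * (k - 2)"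
          using sum_bounded_above[of "f i ` V" "\<lambda>y. card (F i y)" "k - 2"] few[OF i] by simp
        also have "\<dots> \<le> L * (k - 2)"
          using lines[OF i] by simp
        finally show "card (\<Union>y\<in>f i ` V. F i y) \<le> L * (k - 2)" .
      qed
      also have "\<dots> = r * L * (k - 2)"
        by simp
      finally show False
        using big by simp
    qed
    then obtain i y where i: "i \<in> {1..r}" and "k - 1 \<le> card (F i y)"
      by blast
    then obtain S where S: "S \<subseteq> F i y" "card S = k - 1" "finite S"
      using obtain_subset_with_card_n by metis
    have "S \<in> nsets {v \<in> verts G. g v = i} (k - 1)"
      using S by (auto simp: nsets_def G_def F_def)
    moreover have "unicolored G i S"
      unfolding unicolored_iff
    proof (intro ballI impI)
      fix u v assume "u \<in> S" "v \<in> S" "u \<noteq> v"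
      then show "color G {u, v} = i"
        using S(1) i by (auto simp: G_def F_def intro!: c_line)
    qed
    ultimately show "\<exists>i\<in>{1..r}. \<exists>S\<in>nsets {v \<in> verts G. g v = i} (k - 1). unicolored G i S"
      using i by blast
  qed (use assms(3) in simp)
  then show ?thesis
    by (auto simp: G_def)
qed

lemma ex_semisaturated_affine:
  fixes m :: nat
  assumes "r \<ge> 1" "k \<ge> 2" "m \<ge> 1" and A: "A = r * (k - 2) + 1"
    and nodvd: "\<And>d x. 0 < d \<Longrightarrow> d < r \<Longrightarrow> 0 < x \<Longrightarrow> x < A \<Longrightarrow> \<not> m dvd d * x"
  shows "\<exists>G :: nat colored_graph. semisaturated r k G \<and> card (verts G) = A * m"
proof -
  \<comment> \<open>The number \<open>v\<close> encodes the grid point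
    \<open>(x, y) = (v div m, v mod m)\<close>; \<open>f a v\<close> is the intercept of the line of
    slope \<open>-a\<close> through it.\<close>
  define f where "f a v = (v mod m + a * (v div m)) mod m" for a v :: nat
  have aux: "u = v" if ab: "a < b" "a \<in> {1..r}" "b \<in> {1..r}" and uv: "u < A * m" "v < A * m"
      and eq: "f a u = f a v" "f b u = f b v" for a b u v
  proof -
    define x x' y y' where "x = u div m" and "x' = v div m" and "y = u mod m" and "y' = v mod m"
    have xA: "x < A" "x' < A"
      using uv by (simp_all add: x_def x'_def less_mult_imp_div_less)
    have eq_int: "int m dvd (int y + int e * int x) - (int y' + int e * int x')" if "f e u = f e v" for e
    proof -
      have "int (y + e * x) mod int m = int (y' + e * x') mod int m"
        using that unfolding f_def x_def x'_def y_def y'_def by (metis zmod_int)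
      then show ?thesis
        unfolding mod_eq_dvd_iff by simp
    qed
    \<comment> \<open>Subtracting the two congruences eliminates \<open>y\<close>, leaving a product
      that \<open>nodvd\<close> excludes unless \<open>x = x'\<close>.\<close>
    have "int m dvd (int y + int b * int x - (int y' + int b * int x')) -
        (int y + int a * int x - (int y' + int a * int x'))"
      by (rule dvd_diff) (use eq eq_int in blast)+
    also have "\<dots> = (int b - int a) * (int x - int x')"
      by (simp add: algebra_simps)
    finally have dvd: "int m dvd (int b - int a) * (int x - int x')" .
    have ba: "int b - int a = int (b - a)" "0 < b - a" "b - a < r"
      using ab by auto
    have "x = x'"
    proof (rule ccontr)
      assume "x \<noteq> x'"
      then consider "x < x'" | "x' < x"
        by linarith
      then show False
      proof cases
        case 1
        then have "(int b - int a) * (int x - int x') = - int ((b - a) * (x' - x))"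
          unfolding ba(1) of_nat_mult of_nat_diff[OF less_imp_le[OF 1]] by (simp add: algebra_simps)
        then have "m dvd (b - a) * (x' - x)"
          using dvd by (metis dvd_minus_iff of_nat_dvd_iff)
        then show False
          using nodvd[of "b - a" "x' - x"] ba 1 xA by simp
      next
        case 2
        then have "(int b - int a) * (int x - int x') = int ((b - a) * (x - x'))"
          unfolding ba(1) of_nat_mult of_nat_diff[OF less_imp_le[OF 2]] by simp
        then have "m dvd (b - a) * (x - x')"
          using dvd by (metis of_nat_dvd_iff)
        then show False
          using nodvd[of "b - a" "x - x'"] ba 2 xA by simp
      qed
    qed
    then have "int m dvd int y - int y'"
      using eq_int[OF eq(1)] by simp
    then have "y mod m = y' mod m"
      by (metis mod_eq_dvd_iff of_nat_eq_iff zmod_int)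
    then have "y = y'"
      by (simp add: y_def y'_def)
    with \<open>x = x'\<close> show "u = v"
      unfolding x_def x'_def y_def y'_def by (metis div_mult_mod_eq)
  qed
  have "\<exists>G. semisaturated r k G \<and> verts G = {..<A * m}"
  proof (rule ex_semisaturated_of_lines[where f = f and L = m])
    fix a b u v assume *: "a \<in> {1..r}" "b \<in> {1..r}" "u \<in> {..<A * m}" "v \<in> {..<A * m}" "u \<noteq> v"
      "f a u = f a v" "f b u = f b v"
    show "a = b"
      using aux[of a b u v] aux[of b a u v] * by (cases a b rule: linorder_cases) auto
  next
    fix a
    have "f a ` {..<A * m} \<subseteq> {..<m}"
      using assms(3) by (auto simp: f_def)
    then show "card (f a ` {..<A * m}) \<le> m"
      using card_mono[of "{..<m}"] by fastforce
  next
    \<comment> \<open>The \<open>+ 1\<close> in \<open>A\<close> makes this strict.\<close>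
    show "r * m * (k - 2) < card {..<A * m}"
      using assms(3) by (simp add: A algebra_simps)
  qed (use assms in auto)
  then show ?thesis
    by (metis card_lessThan)
qed

section \<open>Bounds for \<open>ssat\<close>\<close>

lemma ssat_le:
  "semisaturated r k (G :: nat colored_graph) \<Longrightarrow> ssat r k \<le> card (verts G)"
  unfolding ssat_def by (rule Least_le) blast

text \<open>Take the modulus \<open>r * A\<close>: a product \<open>d * x\<close> with
  \<open>0 < d < r\<close> and \<open>0 < x < A\<close> is positive and smaller, hence not a
  multiple. The graph also shows that the minimum defining \<open>ssat\<close> is over a nonempty
  set.\<close>

lemma
  assumes "r \<ge> 1" "k \<ge> 2"
  shows ssat_le_cubic: "ssat r k \<le> r * (r * (k - 2) + 1)\<^sup>2"
    and ssat_attained: "\<exists>G :: nat colored_graph. semisaturated r k G \<and> card (verts G) = ssat r k"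
proof -
  define A where "A = r * (k - 2) + 1"
  have "\<not> r * A dvd d * x" if "0 < d" "d < r" "0 < x" "x < A" for d x
    using that mult_strict_mono'[of d r x A] by (auto dest: dvd_imp_le)
  then obtain G :: "nat colored_graph" where G: "semisaturated r k G" "card (verts G) = A * (r * A)"
    using ex_semisaturated_affine[OF assms _ A_def, of "r * A"] assms by (auto simp: A_def)
  then show "ssat r k \<le> r * (r * (k - 2) + 1)\<^sup>2"
    using ssat_le[OF G(1)] G(2) unfolding A_def[symmetric] by (simp add: power2_eq_square mult.left_commute)
  show "\<exists>G :: nat colored_graph. semisaturated r k G \<and> card (verts G) = ssat r k"
    unfolding ssat_def by (rule LeastI_ex) (use G in blast)
qed

text \<open>A prime dividing \<open>d * x\<close> divides a factor, but both are positive and below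
  \<open>p\<close>. For \<open>d\<close> this uses \<open>r < p\<close>, which follows from
  \<open>k \<ge> 3\<close>.\<close>

lemma ssat_le_prime:
  assumes "r \<ge> 1" "k \<ge> 3" "prime p" "r * (k - 2) + 1 \<le> p"
  shows "ssat r k \<le> (r * (k - 2) + 1) * p"
proof -
  have "1 \<le> k - 2"
    using assms(2) by linarith
  then have "r * 1 \<le> r * (k - 2)"
    by (rule mult_le_mono2)
  then have "r < p"
    using assms(4) by linarith
  then have "\<not> p dvd d * x" if "0 < d" "d < r" "0 < x" "x < r * (k - 2) + 1" for d x
    using that assms(3,4) by (auto simp: prime_dvd_mult_iff dest!: dvd_imp_le)
  then show ?thesis
    using ex_semisaturated_affine[OF assms(1) _ _ refl, of k p] assms prime_gt_0_nat[OF assms(3)]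
    by (auto simp: Suc_le_eq dest!: ssat_le)
qed

lemma ssat_ge_square:
  assumes "r \<ge> 2" "k \<ge> 2"
  shows "(k - 1)\<^sup>2 \<le> ssat r k"
proof -
  obtain G :: "nat colored_graph" where "semisaturated r k G" "card (verts G) = ssat r k"
    using ssat_attained[of r k] assms by auto
  then show ?thesis
    using semisaturated_card_ge_clique_size[of r k G] assms by simp
qed

text \<open>Otherwise some vertex coloring \<open>f\<close> has no edge of color \<open>i\<close>
  inside any class \<open>f = i\<close>, whereas a clique on \<open>k - 1 \<ge> 2\<close> vertices
  contains an edge.\<close>

lemma semisaturated_card_ge_colors:
  fixes G :: "'v colored_graph"
  assumes G: "semisaturated r k G" and inf: "infinite (UNIV :: 'v set)" and "k \<ge> 3"
  shows "r\<^sup>2 \<le> 4 * card (verts G)"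
proof (rule ccontr)
  assume "\<not> ?thesis"
  moreover have "finite (verts G)"
    using G by (simp add: semisaturated_def colored_complete_def)
  ultimately obtain f where f: "f \<in> verts G \<rightarrow> {1..r}"
    "\<And>u v. u \<in> verts G \<Longrightarrow> v \<in> verts G \<Longrightarrow> u \<noteq> v \<Longrightarrow> f u = f v \<Longrightarrow> color G {u, v} \<noteq> f u"
    using independent_color_partition[of "verts G" "{1..r}" "color G"] by auto
  obtain i S where S: "S \<in> nsets {v \<in> verts G. f v = i} (k - 1)" "unicolored G i S"
    using semisaturated_obtains[OF G inf f(1)] by metis
  then have "2 \<le> card S" "S \<subseteq> {v \<in> verts G. f v = i}"
    using assms(3) by (auto simp: nsets_def)
  then obtain u v where uv: "u \<in> S" "v \<in> S" "u \<noteq> v"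
    by (meson card_2_iff' obtain_subset_with_card_n subsetD)
  then have "f u = i" "f v = i" "u \<in> verts G" "v \<in> verts G"
    using \<open>S \<subseteq> _\<close> by auto
  then show False
    using f(2)[of u v] S(2) uv by (auto simp: unicolored_iff)
qed

lemma mult_diff_two_less:
  fixes r k :: nat
  assumes "r \<ge> 1" "k \<ge> 2"
  shows "r * (k - 2) + 1 \<le> r * k"
proof -
  obtain j where "k = j + 2"
    using assms(2) by (metis le_add_diff_inverse2)
  then show ?thesis
    using assms(1) by simp
qed

lemma ssat_le_log:
  assumes "r \<ge> 2" "k \<ge> 3"
  shows "real (ssat r k) \<le> 16 * (real k)\<^sup>2 * (log 2 (real k) + 3) * log 2 (real r) * (real r)\<^sup>2"
proof -
  define A where "A = r * (k - 2) + 1"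
  have Ark: "A \<le> r * k"
    unfolding A_def using assms by (intro mult_diff_two_less) auto
  have "1 \<le> r * (k - 2)"
    using assms by (simp add: Suc_le_eq)
  then have A2: "A \<ge> 2"
    by (simp add: A_def)
  obtain p where p: "prime p" "A \<le> p" "real p \<le> 16 * real A * (log 2 (real A) + 2)"
    using ex_prime_ge_le[OF A2] .
  have l: "log 2 (real r) \<ge> 1" "log 2 (real k) \<ge> 0"
    using assms by (simp_all add: le_log_iff)
  have Ark': "real A \<le> real r * real k"
    using Ark by (metis of_nat_le_iff of_nat_mult)
  then have "log 2 (real A) \<le> log 2 (real r * real k)"
    using A2 assms by (subst log_le_cancel_iff) auto
  also have "\<dots> = log 2 (real r) + log 2 (real k)"
    using assms by (simp add: log_mult)
  \<comment> \<open>Since \<open>log 2 r \<ge> 1\<close>, the part free of \<open>r\<close> may be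
    multiplied by it.\<close>
  also have "\<dots> + 2 \<le> log 2 (real r) * (log 2 (real k) + 3)"
    using mult_right_mono[OF l(1), of "log 2 (real k) + 2"] l by (simp add: algebra_simps)
  finally have lA: "log 2 (real A) + 2 \<le> log 2 (real r) * (log 2 (real k) + 3)"
    by simp
  have "real (ssat r k) \<le> real A * real p"
    using ssat_le_prime[of r k p] p assms unfolding A_def[symmetric] by (metis of_nat_le_iff of_nat_mult one_le_numeral order_trans)
  also have "\<dots> \<le> real A * (16 * real A * (log 2 (real A) + 2))"
    using p by (intro mult_left_mono) auto
  also have "\<dots> \<le> real A * (16 * real A * (log 2 (real r) * (log 2 (real k) + 3)))"
    using lA by (intro mult_left_mono) auto
  also have "\<dots> = (real A)\<^sup>2 * (16 * (log 2 (real r) * (log 2 (real k) + 3)))"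
    by (simp add: power2_eq_square)
  also have "\<dots> \<le> (real r * real k)\<^sup>2 * (16 * (log 2 (real r) * (log 2 (real k) + 3)))"
    using Ark' l by (intro mult_right_mono power_mono) auto
  also have "\<dots> = 16 * (real k)\<^sup>2 * (log 2 (real k) + 3) * log 2 (real r) * (real r)\<^sup>2"
    by (simp add: power_mult_distrib)
  finally show ?thesis .
qed

theorem theorem1p4:
  shows "(\<forall>r::nat. r \<ge> 2 \<longrightarrow>
           (\<exists>c C :: real. \<exists>k0 :: nat. c > 0 \<and> C > 0 \<and>
             (\<forall>k::nat. k \<ge> k0 \<longrightarrow>
               c * (real k)\<^sup>2 \<le> real (ssat r k) \<and> real (ssat r k) \<le> C * (real k)\<^sup>2)))
       \<and>
         (\<forall>k::nat. k \<ge> 3 \<longrightarrow>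
           (\<exists>C :: real. C > 0 \<and>
             (\<forall>r::nat. r \<ge> 3 \<longrightarrow>
               1 / 4 * (real r)\<^sup>2 \<le> real (ssat r k) \<and>
               real (ssat r k) \<le> C * (log 2 (real r)) ^ (8 * (k - 1)\<^sup>2) * (real r)\<^sup>2)))"
proof (intro conjI allI impI)
  fix r :: nat assume r: "r \<ge> 2"
  \<comment> \<open>The constant \<open>1 / 4\<close> comes from \<open>k / 2 \<le> k - 1\<close>,
    and \<open>r ^ 3\<close> from \<open>r * (r * k)\<^sup>2\<close>.\<close>
  have "1 / 4 * (real k)\<^sup>2 \<le> real (ssat r k) \<and> real (ssat r k) \<le> real r ^ 3 * (real k)\<^sup>2"
    if k: "k \<ge> 3" for k
  proof
    have "(real k / 2)\<^sup>2 \<le> (real (k - 1))\<^sup>2"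
      using k by (intro power_mono) auto
    also have "\<dots> \<le> real (ssat r k)"
      unfolding of_nat_power[symmetric] of_nat_le_iff using r k by (intro ssat_ge_square) auto
    finally show "1 / 4 * (real k)\<^sup>2 \<le> real (ssat r k)"
      by (simp add: power_divide)
    have "r * (k - 2) + 1 \<le> r * k"
      using r k by (intro mult_diff_two_less) auto
    then have "r * (r * (k - 2) + 1)\<^sup>2 \<le> r * (r * k)\<^sup>2"
      by (intro mult_left_mono power_mono) auto
    then have "ssat r k \<le> r * (r * k)\<^sup>2"
      by (rule order_trans[OF ssat_le_cubic, rotated -1]) (use r k in auto)
    then have "real (ssat r k) \<le> real (r * (r * k)\<^sup>2)"
      by (simp only: of_nat_le_iff)
    then show "real (ssat r k) \<le> real r ^ 3 * (real k)\<^sup>2"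
      by (simp add: power2_eq_square power3_eq_cube algebra_simps)
  qed
  then show "\<exists>c C :: real. \<exists>k0 :: nat. c > 0 \<and> C > 0 \<and>
             (\<forall>k::nat. k \<ge> k0 \<longrightarrow>
               c * (real k)\<^sup>2 \<le> real (ssat r k) \<and> real (ssat r k) \<le> C * (real k)\<^sup>2)"
    using r by (intro exI[of _ "1 / 4"] exI[of _ "real r ^ 3"] exI[of _ 3]) auto
next
  fix k :: nat assume k: "k \<ge> 3"
  define C where "C = 16 * (real k)\<^sup>2 * (log 2 (real k) + 3)"
  have "log 2 (real k) + 3 > 0"
    using k by (intro add_nonneg_pos) auto
  then have "C > 0"
    using k by (simp add: C_def)
  moreover have "1 / 4 * (real r)\<^sup>2 \<le> real (ssat r k) \<and>
      real (ssat r k) \<le> C * (log 2 (real r)) ^ (8 * (k - 1)\<^sup>2) * (real r)\<^sup>2" if r: "r \<ge> 3" for r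
  proof
    obtain G :: "nat colored_graph" where "semisaturated r k G" "card (verts G) = ssat r k"
      using ssat_attained[of r k] r k by auto
    then have "r\<^sup>2 \<le> 4 * ssat r k"
      using semisaturated_card_ge_colors[of r k G] k by simp
    then have "real (r\<^sup>2) \<le> real (4 * ssat r k)"
      by (simp only: of_nat_le_iff)
    then show "1 / 4 * (real r)\<^sup>2 \<le> real (ssat r k)"
      by simp
    have "log 2 (real r) \<ge> 1"
      using r by (simp add: le_log_iff)
    \<comment> \<open>The construction costs one logarithm, which is at least 1 and so is bounded by
      any positive power of itself.\<close>
    then have "log 2 (real r) \<le> log 2 (real r) ^ (8 * (k - 1)\<^sup>2)"
      using k by (intro self_le_power) auto
    then have "C * log 2 (real r) * (real r)\<^sup>2 \<le> C * (log 2 (real r)) ^ (8 * (k - 1)\<^sup>2) * (real r)\<^sup>2"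
      using \<open>C > 0\<close> by (intro mult_right_mono mult_left_mono) auto
    then show "real (ssat r k) \<le> C * (log 2 (real r)) ^ (8 * (k - 1)\<^sup>2) * (real r)\<^sup>2"
      using ssat_le_log[of r k] r k unfolding C_def by linarith
  qed
  ultimately show "\<exists>C :: real. C > 0 \<and>
             (\<forall>r::nat. r \<ge> 3 \<longrightarrow>
               1 / 4 * (real r)\<^sup>2 \<le> real (ssat r k) \<and>
               real (ssat r k) \<le> C * (log 2 (real r)) ^ (8 * (k - 1)\<^sup>2) * (real r)\<^sup>2)"
    by blast
qed

end
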